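(* No filter-based semantics is vertex-covering.
   Context: Fix pairwise disjoint countably infinite sets $\mathbb V$ (vertex identifiers), $\mathbb E$ (edge identifiers), $\mathbb L$ (labels). Regular expressions are given by $R ::= \varepsilon \mid a \mid R^* \mid R\cdot R\mid R+R$ with $a\in\mathbb L$; $L(R)$ is the denoted language. A walk is a finite nonempty alternating sequence $w=(v_0,e_1,v_1,\dots,e_k,v_k)$ with $v_i\in\mathbb V$, $e_i\in\mathbb E$; its length is $k$. $\mathsf{Walks}$ is the set of all walks (independently of any database). A database $D=(L_D,V_D,E_D,\mathsf{Src}_D,\mathsf{Tgt}_D,\mathsf{Lbl}_D)$ consists of finite sets $L_D\subset\mathbb L$, $V_D\subset\mathbb V$, $E_D\subset\mathbb E$ and functions $\mathsf{Src}_D,\mathsf{Tgt}_D:E_D\to V_D$, $\mathsf{Lbl}_D:E_D\to L_D$. $\mathsf{Walks}(D)$ is the set of walks $(v_0,e_1,\dots,e_k,v_k)$ with all $v_i\in V_D$, $e_i\in E_D$, $\mathsf{Src}_D(e_i)=v_{i-1}$ and $\mathsf{Tgt}_D(e_i)=v_i$; the label $\mathsf{Lbl}_D(w)$ of such a walk is the word $\mathsf{Lbl}_D(e_1)\cdots\mathsf{Lbl}_D(e_k)$. $\mathsf{Matches}(D,R)=\{w\in\mathsf{Walks}(D): \mathsf{Lbl}_D(w)\in L(R)\}$. A semantics $S$ is a function mapping every database $D$ and regular expression $R$ to a finite subset $S(D,R)$ of $\mathsf{Matches}(D,R)$. $S$ is filter-based if there is a function $f:\mathsf{Walks}\to\{\top,\bot\}$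 with $S(D,R)=\{w\in\mathsf{Matches}(D,R): f(w)=\top\}$ for all $D,R$. A walk covers a vertex $v$ if $v$ occurs in it; a set of walks covers $v$ if some walk in it covers $v$. $S$ is vertex-covering if for all $D,R$, every vertex covered by $\mathsf{Matches}(D,R)$ is covered by $S(D,R)$. *)

theory Defs
  imports Main "HOL-Library.FuncSet" "HOL-Library.Countable" "HOL-Library.Infinite_Typeclass"
begin

text \<open>
  The pairwise disjoint, countably infinite sets of vertex identifiers, edge identifiers and
  labels are three type parameters of sort \<open>{countable, infinite}\<close>; disjointness is
  ensured by typing.
\<close>

datatype 'l rexp =
    Eps
  | Atom 'l
  | Star "'l rexp"
  | Conc "'l rexp" "'l rexp"
  | Alt "'l rexp" "'l rexp"

inductive_set star :: "'l list set \<Rightarrow> 'l list set" for A :: "'l list set" where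
  star_Nil: "[] \<in> star A"
| star_append: "u \<in> A \<Longrightarrow> w \<in> star A \<Longrightarrow> u @ w \<in> star A"

fun lang :: "'l rexp \<Rightarrow> 'l list set" where
  "lang Eps = {[]}"
| "lang (Atom a) = {[a]}"
| "lang (Star R) = star (lang R)"
| "lang (Conc R R') = {u @ w | u w. u \<in> lang R \<and> w \<in> lang R'}"
| "lang (Alt R R') = lang R \<union> lang R'"

text \<open>
  \<open>Walk v\<^sub>0 [(e\<^sub>1, v\<^sub>1), \<dots>, (e\<^sub>k, v\<^sub>k)]\<close> stands for the alternating sequence
  \<open>(v\<^sub>0, e\<^sub>1, v\<^sub>1, \<dots>, e\<^sub>k, v\<^sub>k)\<close>. The type does not refer to any database, so it
  plays the role of the set of all walks.
\<close>

datatype ('v, 'e) walk = Walk 'v "('e \<times> 'v) list"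

fun walk_verts :: "('v, 'e) walk \<Rightarrow> 'v list" where
  "walk_verts (Walk v xs) = v # map snd xs"

fun walk_edges :: "('v, 'e) walk \<Rightarrow> 'e list" where
  "walk_edges (Walk v xs) = map fst xs"

record ('v, 'e, 'l) database =
  labels :: "'l set"
  verts :: "'v set"
  edges :: "'e set"
  src :: "'e \<Rightarrow> 'v"
  tgt :: "'e \<Rightarrow> 'v"
  lbl :: "'e \<Rightarrow> 'l"

text \<open>
  The three functions have domain \<open>edges D\<close>; extensional function spaces fix their values
  outside that domain, so that each database is represented by exactly one record.
\<close>

definition is_database :: "('v, 'e, 'l) database \<Rightarrow> bool" where
  "is_database D \<longleftrightarrow>
     finite (labels D) \<and> finite (verts D) \<and> finite (edges D) \<and>
     src D \<in> edges D \<rightarrow>\<^sub>E verts D \<and>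
     tgt D \<in> edges D \<rightarrow>\<^sub>E verts D \<and>
     lbl D \<in> edges D \<rightarrow>\<^sub>E labels D"

definition walks :: "('v, 'e, 'l) database \<Rightarrow> ('v, 'e) walk set" where
  "walks D = {w.
     set (walk_verts w) \<subseteq> verts D \<and> set (walk_edges w) \<subseteq> edges D \<and>
     (\<forall>i < length (walk_edges w).
        src D (walk_edges w ! i) = walk_verts w ! i \<and>
        tgt D (walk_edges w ! i) = walk_verts w ! Suc i)}"

definition walk_label :: "('v, 'e, 'l) database \<Rightarrow> ('v, 'e) walk \<Rightarrow> 'l list" where
  "walk_label D w = map (lbl D) (walk_edges w)"

definition Matches :: "('v, 'e, 'l) database \<Rightarrow> 'l rexp \<Rightarrow> ('v, 'e) walk set" where
  "Matches D R = {w \<in> walks D. walk_label D w \<in> lang R}"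

type_synonym ('v, 'e, 'l) semantics =
  "('v, 'e, 'l) database \<Rightarrow> 'l rexp \<Rightarrow> ('v, 'e) walk set"

definition is_semantics :: "('v, 'e, 'l) semantics \<Rightarrow> bool" where
  "is_semantics S \<longleftrightarrow>
     (\<forall>D R. is_database D \<longrightarrow> finite (S D R) \<and> S D R \<subseteq> Matches D R)"

definition filter_based :: "('v, 'e, 'l) semantics \<Rightarrow> bool" where
  "filter_based S \<longleftrightarrow>
     (\<exists>f :: ('v, 'e) walk \<Rightarrow> bool.
        \<forall>D R. is_database D \<longrightarrow> S D R = {w \<in> Matches D R. f w})"

definition covers :: "('v, 'e) walk \<Rightarrow> 'v \<Rightarrow> bool" where
  "covers w v \<longleftrightarrow> v \<in> set (walk_verts w)"

definition set_covers :: "('v, 'e) walk set \<Rightarrow> 'v \<Rightarrow> bool" where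
  "set_covers W v \<longleftrightarrow> (\<exists>w \<in> W. covers w v)"

definition vertex_covering :: "('v, 'e, 'l) semantics \<Rightarrow> bool" where
  "vertex_covering S \<longleftrightarrow>
     (\<forall>D R. is_database D \<longrightarrow> (\<forall>v. set_covers (Matches D R) v \<longrightarrow> set_covers (S D R) v))"

end

theory Submission
  imports Defs
begin

text \<open>
  On the database with one vertex and one loop labelled \<open>a\<close>, a vertex-covering semantics must
  return a walk of length \<open>n\<close> for the expression \<open>a\<^sup>n\<close>, for every \<open>n\<close>. A filter that accepts
  these walks accepts them for \<open>a\<^sup>*\<close> as well, whose answer is then infinite.
\<close>

fun atom_power :: "'l \<Rightarrow> nat \<Rightarrow> 'l rexp" where
  "atom_power a 0 = Eps"
| "atom_power a (Suc n) = Conc (Atom a) (atom_power a n)"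

lemma lang_atom_power: "lang (atom_power a n) = {replicate n a}"
  by (induction n) auto

lemma replicate_in_lang_Star_Atom: "replicate n a \<in> lang (Star (Atom a))"
proof (induction n)
  case 0
  show ?case by (simp add: star_Nil)
next
  case (Suc n)
  then show ?case using star_append[of "[a]" "{[a]}" "replicate n a"] by simp
qed

text \<open>The restricted lambdas put the three functions into the extensional spaces that
  \<open>is_database\<close> demands.\<close>

definition loop_database :: "'v \<Rightarrow> 'e \<Rightarrow> 'l \<Rightarrow> ('v, 'e, 'l) database" where
  "loop_database v e a = \<lparr>labels = {a}, verts = {v}, edges = {e},
     src = (\<lambda>x\<in>{e}. v), tgt = (\<lambda>x\<in>{e}. v), lbl = (\<lambda>x\<in>{e}. a)\<rparr>"

lemma is_database_loop_database: "is_database (loop_database v e a)"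
  by (simp add: is_database_def loop_database_def)

lemma replicate_walk_in_Matches_loop_database:
  "Walk v (replicate n (e, v)) \<in> Matches (loop_database v e a) (atom_power a n)"
  by (auto simp: Matches_def walks_def walk_label_def loop_database_def lang_atom_power
      nth_Cons split: nat.split)

theorem lemma50:
  fixes S :: "('v::{countable,infinite}, 'e::{countable,infinite}, 'l::{countable,infinite}) semantics"
  assumes "is_semantics S" and "filter_based S"
  shows "\<not> vertex_covering S"
proof
  assume covering: "vertex_covering S"
  obtain f where f: "\<And>D R. is_database D \<Longrightarrow> S D R = {w \<in> Matches D R. f w}"
    using \<open>filter_based S\<close> unfolding filter_based_def by blast
  fix v :: 'v and e :: 'e and a :: 'l
  define D where "D = loop_database v e a"
  have D: "is_database D"
    unfolding D_def by (rule is_database_loop_database)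
  have "\<exists>w \<in> S D (Star (Atom a)). length (walk_edges w) = n" for n
  proof -
    have "set_covers (Matches D (atom_power a n)) v"
      using replicate_walk_in_Matches_loop_database[of v n e a]
      unfolding D_def set_covers_def covers_def by force
    \<comment> \<open>Covering yields some match, not a prescribed walk; its length is still
      \<open>n\<close> because \<open>atom_power a n\<close> denotes a single word.\<close>
    then obtain w where w: "w \<in> S D (atom_power a n)"
      using covering D unfolding vertex_covering_def set_covers_def by blast
    then have label: "walk_label D w = replicate n a" and "w \<in> walks D" "f w"
      using f[OF D] by (auto simp: Matches_def lang_atom_power)
    \<comment> \<open>The filter \<open>f\<close> sees only the walk, so its verdict carries over
      from one expression to the other.\<close>
    then have "w \<in> S D (Star (Atom a))"
      using f[OF D] replicate_in_lang_Star_Atom[of n a] by (simp add: Matches_def)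
    moreover have "length (walk_edges w) = n"
      using arg_cong[OF label, of length] by (simp add: walk_label_def)
    ultimately show ?thesis by blast
  qed
  \<comment> \<open>Length maps the answer onto all of \<open>nat\<close>, impossible for a finite
    set.\<close>
  then have "(\<lambda>w. length (walk_edges w)) ` S D (Star (Atom a)) = UNIV"
    by (metis UNIV_eq_I image_eqI)
  moreover have "finite (S D (Star (Atom a)))"
    using \<open>is_semantics S\<close> D unfolding is_semantics_def by blast
  ultimately show False
    using finite_imageI infinite_UNIV_nat by metis
qed

end
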